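(* Let $\mathbf{X}_1,\ldots,\mathbf{X}_m\in\mathbb{C}^{d\times d}$ be matrices of rank at most $k$, and let $\{\mathbf{u}_{i,j}\}_{i\in[m],j\in[k]}\subset\mathbb{C}^d$ and $\{\mathbf{v}_{i,j}\}_{i\in[m],j\in[k]}\subset\mathbb{C}^d$ satisfy $\mathbf{X}_i=\sum_{j=1}^k\mathbf{u}_{i,j}\mathbf{v}_{i,j}^*$ for all $i\in[m]$. For $j\in[k]$ set $\mathbf{U}_j:=[\mathbf{u}_{1,j},\ldots,\mathbf{u}_{m,j}]\in\mathbb{C}^{d\times m}$ and $\mathbf{V}_j:=[\mathbf{v}_{1,j},\ldots,\mathbf{v}_{m,j}]\in\mathbb{C}^{d\times m}$, and let \[ \mathbf{A}:=\begin{pmatrix}\mathbf{V}_1^*\\ \vdots\\ \mathbf{V}_k^*\end{pmatrix}(\mathbf{U}_1,\ldots,\mathbf{U}_k)\in\mathbb{C}^{km\times km}. \] Then \[ \mu[\mathbf{X}_1,\ldots,\mathbf{X}_m](x)=x^{d-m}\cdot\psi_{k,m}[k\cdot\mathbf{A}](x). \]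
   Context: $[m]=\{1,\ldots,m\}$. The mixed characteristic polynomial is $\mu[\mathbf{X}_1,\ldots,\mathbf{X}_m](x):=\prod_{i=1}^m(1-\partial_{z_i})\det[x\mathbf{I}_d+\sum_{i=1}^m z_i\mathbf{X}_i]|_{z_1=\cdots=z_m=0}$. $\mathcal{P}_k(m)$ denotes the set of $k$-tuples $\mathcal{S}=(S_1,\ldots,S_k)$ of pairwise disjoint (possibly empty) subsets of $[m]$ with union $[m]$. For $\mathbf{B}\in\mathbb{C}^{km\times km}$, $\mathbf{B}(\mathcal{S})$ is the principal submatrix with rows and columns indexed by $S_1\cup(m+S_2)\cup\cdots\cup((k-1)m+S_k)$, and $\psi_{k,m}[\mathbf{B}](x):=\frac{1}{k^m}\sum_{\mathcal{S}\in\mathcal{P}_k(m)}\det[x\mathbf{I}_m-\mathbf{B}(\mathcal{S})]$. The identity is understood as an identity of rational functions in $x$. *)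

theory Defs
  imports
    "Jordan_Normal_Form.DL_Rank"
    "Jordan_Normal_Form.DL_Submatrix"
    "Jordan_Normal_Form.Schur_Decomposition"
    "HOL-Library.Poly_Mapping"
    "HOL-Library.Disjoint_Sets"
    "HOL-Computational_Algebra.Polynomial_Factorial"
begin

text \<open>
  As usual for this matrix library, all indices start at 0, so the index set $[m]$ is
  \<^term>\<open>{..<m}\<close>.
\<close>

definition mat_sum :: "nat \<Rightarrow> nat \<Rightarrow> ('i \<Rightarrow> 'a :: comm_monoid_add mat) \<Rightarrow> 'i set \<Rightarrow> 'a mat" where
  "mat_sum nr nc M I = mat nr nc (\<lambda>(r, c). \<Sum>i\<in>I. M i $$ (r, c))"

text \<open>The rank-one matrix $u v^*$.\<close>

definition outer_prod :: "complex vec \<Rightarrow> complex vec \<Rightarrow> complex mat" where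
  "outer_prod u v = mat (dim_vec u) (dim_vec v) (\<lambda>(r, c). u $ r * cnj (v $ c))"

text \<open>
  The block matrices $(M_0, \dots, M_{k-1})$, with blocks of size \<open>n \<times> m\<close>, and
  $(M_0; \dots; M_{k-1})$ (stacked vertically), with blocks of size \<open>m \<times> n\<close>.
\<close>

definition block_row :: "nat \<Rightarrow> nat \<Rightarrow> nat \<Rightarrow> (nat \<Rightarrow> 'a mat) \<Rightarrow> 'a mat" where
  "block_row n m k M = mat n (k * m) (\<lambda>(r, c). M (c div m) $$ (r, c mod m))"

definition block_col :: "nat \<Rightarrow> nat \<Rightarrow> nat \<Rightarrow> (nat \<Rightarrow> 'a mat) \<Rightarrow> 'a mat" where
  "block_col m n k M = mat (k * m) n (\<lambda>(r, c). M (r div m) $$ (r mod m, c))"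

text \<open>
  Polynomials in the variables $z_0, z_1, \dots$ with coefficients in \<open>'a\<close>: a monomial is a
  finitely supported exponent function, and a polynomial is a finitely supported function from
  monomials to coefficients, multiplied by convolution.
\<close>

type_synonym 'a mpol = "(nat \<Rightarrow>\<^sub>0 nat) \<Rightarrow>\<^sub>0 'a"

definition mconst :: "'a :: zero \<Rightarrow> 'a mpol" where
  "mconst a = Poly_Mapping.single 0 a"

definition mvar :: "nat \<Rightarrow> 'a :: zero_neq_one mpol" where
  "mvar i = Poly_Mapping.single (Poly_Mapping.single i 1) 1"

text \<open>
  The partial derivative with respect to $z_i$. For monomials not containing $z_i$ the
  subtraction of exponents truncates, but the coefficient is then 0.
\<close>

definition mderiv :: "nat \<Rightarrow> 'a :: comm_semiring_1 mpol \<Rightarrow> 'a mpol" where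
  "mderiv i p = (\<Sum>t\<in>Poly_Mapping.keys p.
     Poly_Mapping.single (t - Poly_Mapping.single i 1)
       (of_nat (Poly_Mapping.lookup t i) * Poly_Mapping.lookup p t))"

lemma lookup_mderiv:
  "Poly_Mapping.lookup (mderiv i p) t =
     of_nat (Poly_Mapping.lookup t i + 1) * Poly_Mapping.lookup p (t + Poly_Mapping.single i 1)"
proof -
  let ?e = "Poly_Mapping.single i (1 :: nat)"
  let ?c = "\<lambda>s. of_nat (Poly_Mapping.lookup s i) * Poly_Mapping.lookup p s"
  have eq: "(?c s when s - ?e = t) = (if s = t + ?e then ?c s else 0)" for s
  proof (cases "Poly_Mapping.lookup s i = 0")
    case False
    have "s - ?e = t \<longleftrightarrow> s = t + ?e"
    proof
      assume "s - ?e = t"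
      then show "s = t + ?e"
        using False
        by (auto intro!: poly_mapping_eqI simp: lookup_add lookup_minus lookup_single when_def)
    qed simp
    then show ?thesis by (simp add: when_def)
  qed (auto simp: when_def lookup_add)
  have "Poly_Mapping.lookup (mderiv i p) t = (\<Sum>s\<in>Poly_Mapping.keys p. ?c s when s - ?e = t)"
    unfolding mderiv_def by (simp add: lookup_sum lookup_single)
  also have "\<dots> = (\<Sum>s\<in>Poly_Mapping.keys p. if s = t + ?e then ?c s else 0)"
    unfolding eq ..
  also have "\<dots> = ?c (t + ?e)"
    by (simp add: sum.delta in_keys_iff)
  finally show ?thesis by (simp add: lookup_add)
qed

text \<open>The value at $z_0 = z_1 = \dots = 0$ is the constant coefficient.\<close>

definition meval0 :: "'a :: zero mpol \<Rightarrow> 'a" where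
  "meval0 p = Poly_Mapping.lookup p 0"

text \<open>
  The determinant is taken over the ring of polynomials in the $z_i$ with coefficients in the
  polynomials in $x$, where $x$ is \<^term>\<open>[:0, 1:] :: complex poly\<close>.
\<close>

definition mixed_char_poly :: "nat \<Rightarrow> nat \<Rightarrow> (nat \<Rightarrow> complex mat) \<Rightarrow> complex poly" where
  "mixed_char_poly d m X =
     meval0 (foldr (\<lambda>i p. p - mderiv i p) [0..<m]
       (det (mconst [:0, 1:] \<cdot>\<^sub>m 1\<^sub>m d
             + mat_sum d d (\<lambda>i. mvar i \<cdot>\<^sub>m map_mat (\<lambda>a. mconst [:a:]) (X i)) {..<m})))"

definition ordered_partitions :: "nat \<Rightarrow> nat \<Rightarrow> nat set list set" where
  "ordered_partitions k m =
     {S. length S = k \<and> disjoint_family_on (\<lambda>j. S ! j) {..<k} \<and> (\<Union>j<k. S ! j) = {..<m}}"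

lemma finite_ordered_partitions: "finite (ordered_partitions k m)"
proof (rule finite_subset)
  show "ordered_partitions k m \<subseteq> {S. set S \<subseteq> Pow {..<m} \<and> length S = k}"
    unfolding ordered_partitions_def by (fastforce simp: in_set_conv_nth)
  show "finite {S. set S \<subseteq> Pow {..<m} \<and> length S = k}"
    by (rule finite_lists_length_eq) simp
qed

definition partition_submatrix :: "nat \<Rightarrow> nat \<Rightarrow> 'a mat \<Rightarrow> nat set list \<Rightarrow> 'a mat" where
  "partition_submatrix k m B S =
     (let I = (\<Union>j<k. (\<lambda>s. j * m + s) ` (S ! j)) in submatrix B I I)"

definition psi :: "nat \<Rightarrow> nat \<Rightarrow> complex mat \<Rightarrow> complex poly" where
  "psi k m B = smult (1 / of_nat k ^ m)
     (\<Sum>S\<in>ordered_partitions k m. char_poly (partition_submatrix k m B S))"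

end

theory Submission
  imports Defs
begin

text \<open>
  Only the coefficients of $z_i^0$ and $z_i^1$ survive $1 - \partial_{z_i}$ at $z_i = 0$, and they
  depend on $X_i$ in an affine way. Since $X_i$ is the average over \<open>j\<close> of the rank-one matrices
  $k u_{i,j} v_{i,j}^*$, its mixed characteristic polynomial is the average, over all
  $g : [m] \to [k]$, of those of the families $k u_{i,g(i)} v_{i,g(i)}^*$. For rank-one matrices
  the determinant is affine in each $z_i$, so the mixed characteristic polynomial is the
  characteristic polynomial of the sum of the matrices. That sum is a product $P Q$ for which
  $Q P$ is the submatrix of $k A$ selected by \<open>g\<close>, and
  $\det(x I_d - P Q) = x^{d - m} \det(x I_m - Q P)$.
\<close>

section \<open>Expanding determinants along row choices\<close>

text \<open>The members \<open>b i\<close> are entry functions rather than matrices, so that one of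
  them can be exchanged by a function update.\<close>

definition row_mix :: "nat \<Rightarrow> ('i \<Rightarrow> nat \<Rightarrow> nat \<Rightarrow> 'a) \<Rightarrow> (nat \<Rightarrow> 'i) \<Rightarrow> 'a mat" where
  "row_mix d b c = mat d d (\<lambda>(r, s). b (c r) r s)"

lemma row_mix_carrier [simp]: "row_mix d b c \<in> carrier_mat d d"
  by (simp add: row_mix_def)

lemma det_mat:
  "det (mat d d f) =
    (\<Sum>p | p permutes {0..<d}. signof p * (\<Prod>r = 0..<d. f (r, p r)))"
  by (subst det_def'[of _ d]) (auto intro!: sum.cong prod.cong dest: permutes_in_image)

lemma det_row_mix:
  "det (row_mix d b c) =
    (\<Sum>p | p permutes {0..<d}. signof p * (\<Prod>r = 0..<d. b (c r) r (p r)))"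
  by (simp add: row_mix_def det_mat)

text \<open>Multilinearity in the rows: in every Leibniz term the product of sums over
  \<open>S\<close> expands into one product per choice function.\<close>

lemma det_sum_eq_sum_det_row_mix:
  fixes b :: "'i \<Rightarrow> nat \<Rightarrow> nat \<Rightarrow> 'a :: comm_ring_1"
  assumes "finite S"
  shows "det (mat d d (\<lambda>(r, s). \<Sum>i\<in>S. b i r s)) =
    (\<Sum>c\<in>{0..<d} \<rightarrow>\<^sub>E S. det (row_mix d b c))"
proof -
  have "(\<Prod>r = 0..<d. \<Sum>i\<in>S. b i r (p r)) =
      (\<Sum>c\<in>{0..<d} \<rightarrow>\<^sub>E S. \<Prod>r = 0..<d. b (c r) r (p r))" for p
    using assms by (intro prod_sum_PiE) auto
  then show ?thesis
    by (simp add: det_mat det_row_mix sum_distrib_left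
        sum.swap[of _ "{0..<d} \<rightarrow>\<^sub>E S" "{p. p permutes {0..<d}}"])
qed

lemma det_row_mix_scale:
  fixes b :: "'i \<Rightarrow> nat \<Rightarrow> nat \<Rightarrow> 'a :: comm_ring_1"
  shows "det (row_mix d (\<lambda>i r s. w i * b i r s) c) = (\<Prod>r = 0..<d. w (c r)) * det (row_mix d b c)"
  by (simp add: det_row_mix prod.distrib sum_distrib_left mult_ac)

text \<open>If \<open>b i\<close> supplies one row, the determinant is linear in it. If it supplies
  none, the determinant is constant in it, and weights summing to 1 preserve constants.\<close>

lemma det_row_mix_affine:
  fixes b :: "'i \<Rightarrow> nat \<Rightarrow> nat \<Rightarrow> 'a :: comm_ring_1"
  assumes a: "sum a J = 1" and c: "card {r. r < d \<and> c r = i} \<le> 1"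
  shows "det (row_mix d (b(i := \<lambda>r s. \<Sum>j\<in>J. a j * Z j r s)) c) =
    (\<Sum>j\<in>J. a j * det (row_mix d (b(i := Z j)) c))"
proof (cases "\<exists>r<d. c r = i")
  case False
  then have "row_mix d (b(i := Y)) c = row_mix d b c" for Y
    by (auto simp: row_mix_def)
  then show ?thesis
    by (simp add: a flip: sum_distrib_right)
next
  case True
  then obtain r where r: "r < d" "c r = i" by blast
  have uniq: "q = r" if "q < d" "c q = i" for q
  proof -
    have "card {r, q} \<le> card {r. r < d \<and> c r = i}"
      using that r by (intro card_mono) auto
    with c show ?thesis by (cases "q = r") auto
  qed
  \<comment> \<open>Row \<open>r\<close> is the only one taken from \<open>Y\<close>, so each
    Leibniz term contains exactly one factor from \<open>Y\<close>.\<close>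
  have split: "det (row_mix d (b(i := Y)) c) =
      (\<Sum>p | p permutes {0..<d}. Y r (p r) *
        (signof p * (\<Prod>q\<in>{0..<d} - {r}. b (c q) q (p q))))" for Y
    unfolding det_row_mix
  proof (rule sum.cong[OF refl])
    fix p
    have "(\<Prod>q = 0..<d. (b(i := Y)) (c q) q (p q)) =
        Y r (p r) * (\<Prod>q\<in>{0..<d} - {r}. (b(i := Y)) (c q) q (p q))"
      using r by (subst prod.remove[of _ r]) auto
    also have "(\<Prod>q\<in>{0..<d} - {r}. (b(i := Y)) (c q) q (p q)) =
        (\<Prod>q\<in>{0..<d} - {r}. b (c q) q (p q))"
      by (rule prod.cong) (use uniq in auto)
    finally show "signof p * (\<Prod>q = 0..<d. (b(i := Y)) (c q) q (p q)) =
        Y r (p r) * (signof p * (\<Prod>q\<in>{0..<d} - {r}. b (c q) q (p q)))"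
      by (simp add: mult_ac)
  qed
  show ?thesis
    unfolding split sum_distrib_right sum_distrib_left
    by (subst sum.swap) (simp add: mult_ac)
qed

text \<open>Two rows taken from the same rank-one matrix are both multiples of \<open>q\<close>;
  pulling out the factors \<open>p r\<close> leaves two equal rows.\<close>

lemma det_row_mix_rank_one_eq_0:
  fixes b :: "'i \<Rightarrow> nat \<Rightarrow> nat \<Rightarrow> 'a :: comm_ring_1"
  assumes b: "\<And>r s. b i r s = p r * q s" and c: "card {r. r < d \<and> c r = i} > 1"
  shows "det (row_mix d b c) = 0"
proof -
  let ?R = "{r. r < d \<and> c r = i}"
  have "\<not> (\<forall>x\<in>?R. \<forall>y\<in>?R. x = y)"
    using c card_le_Suc0_iff_eq[of ?R] by auto
  then obtain r1 r2 where r: "r1 < d" "r2 < d" "c r1 = i" "c r2 = i" "r1 \<noteq> r2"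
    by blast
  \<comment> \<open>The factor \<open>p r\<close> depends on the row and not only on the chosen
    member. The family is therefore reindexed by rows, with the identity as choice function.\<close>
  define w where "w r = (if c r = i then p r else 1)" for r
  define b' where "b' r r' s = (if c r = i then q s else b (c r) r s)" for r r' s :: nat
  have "det (row_mix d b c) = det (row_mix d (\<lambda>i r s. w i * b' i r s) (\<lambda>r. r))"
    by (rule arg_cong[where f = det]) (auto simp: row_mix_def w_def b'_def b)
  also have "\<dots> = (\<Prod>r = 0..<d. w r) * det (row_mix d b' (\<lambda>r. r))"
    by (rule det_row_mix_scale)
  also have "det (row_mix d b' (\<lambda>r. r)) = 0"
    by (rule det_identical_rows[of _ d r1 r2]) (use r in \<open>auto simp: row_mix_def b'_def row_def\<close>)
  finally show ?thesis by simp
qed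

section \<open>The operators $1 - \partial_{z_i}$ on monomials\<close>

text \<open>The value at 0 of $(1 - \partial)\, z^n$.\<close>

definition one_minus_deriv_coeff :: "nat \<Rightarrow> 'a :: comm_ring_1" where
  "one_minus_deriv_coeff n = (if n = 0 then 1 else if n = 1 then - 1 else 0)"

lemma mderiv_add: "mderiv i (p + q) = mderiv i p + mderiv i q"
  by (rule poly_mapping_eqI) (simp add: lookup_mderiv lookup_add algebra_simps)

lemma mderiv_diff:
  fixes p q :: "'a :: comm_ring_1 mpol"
  shows "mderiv i (p - q) = mderiv i p - mderiv i q"
  by (rule poly_mapping_eqI) (simp add: lookup_mderiv lookup_minus algebra_simps)

lemma mderiv_single:
  "mderiv i (Poly_Mapping.single t a) =
    Poly_Mapping.single (t - Poly_Mapping.single i 1) (of_nat (Poly_Mapping.lookup t i) * a)"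
  by (cases "a = 0") (simp_all add: mderiv_def)

lemma foldr_one_minus_mderiv_add:
  fixes p q :: "'a :: comm_ring_1 mpol"
  shows "foldr (\<lambda>i p. p - mderiv i p) xs (p + q) =
    foldr (\<lambda>i p. p - mderiv i p) xs p + foldr (\<lambda>i p. p - mderiv i p) xs q"
  by (induction xs) (simp_all add: mderiv_add)

lemma foldr_one_minus_mderiv_diff:
  fixes p q :: "'a :: comm_ring_1 mpol"
  shows "foldr (\<lambda>i p. p - mderiv i p) xs (p - q) =
    foldr (\<lambda>i p. p - mderiv i p) xs p - foldr (\<lambda>i p. p - mderiv i p) xs q"
  by (induction xs) (simp_all add: mderiv_diff)

lemma foldr_one_minus_mderiv_sum:
  fixes f :: "'b \<Rightarrow> 'a :: comm_ring_1 mpol"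
  shows "foldr (\<lambda>i p. p - mderiv i p) xs (\<Sum>c\<in>C. f c) =
    (\<Sum>c\<in>C. foldr (\<lambda>i p. p - mderiv i p) xs (f c))"
proof -
  have "foldr (\<lambda>i p. p - mderiv i p) xs (0 :: 'a mpol) = 0"
    using foldr_one_minus_mderiv_diff[of xs 0 0] by simp
  then show ?thesis
    by (induction C rule: infinite_finite_induct) (simp_all add: foldr_one_minus_mderiv_add)
qed

text \<open>The operators act on separate variables, so a monomial yields a product of one-variable
  values. A variable outside \<open>xs\<close> is never differentiated, and setting it to 0 kills
  the monomial.\<close>

lemma meval0_foldr_one_minus_mderiv_single:
  fixes a :: "'a :: comm_ring_1"
  assumes "distinct xs"
  shows "meval0 (foldr (\<lambda>i p. p - mderiv i p) xs (Poly_Mapping.single t a)) =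
    (if Poly_Mapping.keys t \<subseteq> set xs
     then (\<Prod>i\<in>set xs. one_minus_deriv_coeff (Poly_Mapping.lookup t i)) * a else 0)"
  using assms
\<comment> \<open>\<open>foldr\<close> applies the last operator of the list first. Peeling it off
  leaves a difference of two monomials, to which the induction hypothesis applies.\<close>
proof (induction xs arbitrary: t a rule: rev_induct)
  case Nil
  then show ?case by (auto simp: meval0_def lookup_single when_def)
next
  case (snoc x xs)
  let ?L = "\<lambda>t (a :: 'a). meval0 (foldr (\<lambda>i p. p - mderiv i p) xs (Poly_Mapping.single t a))"
  let ?t = "t - Poly_Mapping.single x 1"
  let ?n = "Poly_Mapping.lookup t x"
  have x: "x \<notin> set xs" and IH: "\<And>t a. ?L t a = (if Poly_Mapping.keys t \<subseteq> set xs
     then (\<Prod>i\<in>set xs. one_minus_deriv_coeff (Poly_Mapping.lookup t i)) * a else 0)"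
    using snoc.prems snoc.IH by simp_all
  have keys: "Poly_Mapping.keys s \<subseteq> set xs \<longleftrightarrow>
      Poly_Mapping.keys s \<subseteq> insert x (set xs) \<and> Poly_Mapping.lookup s x = 0" for s :: "nat \<Rightarrow>\<^sub>0 nat"
    using x by (auto simp: in_keys_iff)
  have lk: "Poly_Mapping.lookup ?t i = (if i = x then ?n - 1 else Poly_Mapping.lookup t i)" for i
    by (simp add: lookup_minus lookup_single)
  have keys': "Poly_Mapping.keys ?t \<subseteq> insert x (set xs) \<longleftrightarrow>
      Poly_Mapping.keys t \<subseteq> insert x (set xs)"
    unfolding subset_iff in_keys_iff lk by auto
  have prod: "(\<Prod>i\<in>set xs. one_minus_deriv_coeff (Poly_Mapping.lookup ?t i)) =
      (\<Prod>i\<in>set xs. one_minus_deriv_coeff (Poly_Mapping.lookup t i) :: 'a)"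
    by (rule prod.cong) (use x in \<open>auto simp: lk simp del: One_nat_def\<close>)
  have "meval0 (foldr (\<lambda>i p. p - mderiv i p) (xs @ [x]) (Poly_Mapping.single t a)) =
      ?L t a - ?L ?t (of_nat ?n * a)"
    by (simp add: mderiv_single foldr_one_minus_mderiv_diff meval0_def lookup_minus)
  also have "\<dots> = (if Poly_Mapping.keys t \<subseteq> insert x (set xs)
      then one_minus_deriv_coeff ?n *
        (\<Prod>i\<in>set xs. one_minus_deriv_coeff (Poly_Mapping.lookup t i)) * a else 0)"
  proof -
    \<comment> \<open>For \<open>?n = 0\<close> the derivative vanishes. For \<open>?n = 1\<close>
      only the derivative is free of the variable \<open>x\<close>, whence -1. For
      \<open>?n > 1\<close> both monomials still contain it, and no remaining operator touches
      it.\<close>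
    consider "?n = 0" | "?n = 1" | "?n > 1" by linarith
    then show ?thesis
      unfolding IH keys[of t] keys[of ?t] keys' prod
      unfolding lk by cases (simp_all add: one_minus_deriv_coeff_def)
  qed
  finally show ?case
    using x by simp
qed

lemma mconst_add: "mconst (a + b) = mconst a + mconst b"
  by (simp add: mconst_def single_add)

lemma mconst_mult: "mconst (a * b) = mconst a * mconst b"
  by (simp add: mconst_def mult_single)

lemma comm_ring_hom_mconst: "comm_ring_hom (mconst :: 'a :: comm_ring_1 \<Rightarrow> 'a mpol)"
  by unfold_locales (simp_all add: mconst_add mconst_mult, simp_all add: mconst_def)

text \<open>
  The index \<open>m\<close> plays the role of the summand free of the variables $z_0, \dots, z_{m-1}$.
\<close>

definition mixed_det :: "nat \<Rightarrow> nat \<Rightarrow> (nat \<Rightarrow> nat \<Rightarrow> nat \<Rightarrow> 'a :: comm_ring_1) \<Rightarrow> 'a" where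
  "mixed_det d m b = (\<Sum>c\<in>{0..<d} \<rightarrow>\<^sub>E {..m}.
     (\<Prod>i<m. one_minus_deriv_coeff (card {r. r < d \<and> c r = i})) * det (row_mix d b c))"

text \<open>Give index \<open>i < m\<close> the weight z_i and index \<open>m\<close> the weight 1.
  In the expansion over row choices, \<open>c\<close> then carries the monomial in which the
  exponent of z_i counts the rows assigned to \<open>i\<close>.\<close>

lemma meval0_foldr_one_minus_mderiv_det:
  fixes b :: "nat \<Rightarrow> nat \<Rightarrow> nat \<Rightarrow> 'a :: comm_ring_1"
  shows "meval0 (foldr (\<lambda>i p. p - mderiv i p) [0..<m]
      (det (mat d d (\<lambda>(r, s). mconst (b m r s) + (\<Sum>i<m. mvar i * mconst (b i r s)))))) =
    mixed_det d m b"
proof -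
  interpret mc: comm_ring_hom "mconst :: 'a \<Rightarrow> 'a mpol"
    by (rule comm_ring_hom_mconst)
  define e where "e i = (if i < m then Poly_Mapping.single i 1 else (0 :: nat \<Rightarrow>\<^sub>0 nat))" for i
  define w where "w i = (Poly_Mapping.single (e i) 1 :: 'a mpol)" for i
  let ?F = "\<lambda>p :: 'a mpol. meval0 (foldr (\<lambda>i p. p - mderiv i p) [0..<m] p)"
  have w_lt: "w i = mvar i" if "i < m" for i
    using that by (simp add: w_def e_def mvar_def)
  have w_m: "w m = 1"
    by (simp add: w_def e_def)
  have prod_w: "(\<Prod>r\<in>R. w (c r)) = Poly_Mapping.single (\<Sum>r\<in>R. e (c r)) 1"
    if "finite R" for R and c :: "nat \<Rightarrow> nat"
    using that by induction (simp_all add: w_def mult_single)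
  have "mconst (b m r s) + (\<Sum>i<m. mvar i * mconst (b i r s)) =
      (\<Sum>i\<le>m. w i * mconst (b i r s))" for r s
    by (simp add: w_lt w_m lessThan_Suc_atMost[symmetric] add.commute)
  then have "?F (det (mat d d (\<lambda>(r, s). mconst (b m r s) + (\<Sum>i<m. mvar i * mconst (b i r s))))) =
      ?F (det (mat d d (\<lambda>(r, s). \<Sum>i\<le>m. w i * mconst (b i r s))))"
    by simp
  also have "\<dots> = (\<Sum>c\<in>{0..<d} \<rightarrow>\<^sub>E {..m}.
      ?F (det (row_mix d (\<lambda>i r s. w i * mconst (b i r s)) c)))"
    by (simp add: det_sum_eq_sum_det_row_mix foldr_one_minus_mderiv_sum meval0_def lookup_sum)
  also have "\<dots> = mixed_det d m b"
    unfolding mixed_det_def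
  proof (rule sum.cong[OF refl])
    fix c assume "c \<in> {0..<d} \<rightarrow>\<^sub>E {..m}"
    let ?t = "\<Sum>r = 0..<d. e (c r)"
    have lk: "Poly_Mapping.lookup ?t i = (if i < m then card {r. r < d \<and> c r = i} else 0)" for i
    proof -
      have "Poly_Mapping.lookup ?t i = (\<Sum>r = 0..<d. if i < m \<and> c r = i then 1 else 0)"
        unfolding lookup_sum
        by (rule sum.cong) (auto simp: e_def lookup_single when_def)
      also have "\<dots> = card {r \<in> {0..<d}. i < m \<and> c r = i}"
        by (simp add: sum.If_cases Int_def)
      finally show ?thesis by simp
    qed
    have keys: "Poly_Mapping.keys ?t \<subseteq> set [0..<m]"
      by (auto simp: in_keys_iff lk split: if_splits)
    \<comment> \<open>All entries here are constants, hence so is the determinant, and the whole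
      term is a single monomial.\<close>
    have "row_mix d (\<lambda>i r s. mconst (b i r s)) c = map_mat mconst (row_mix d b c)"
      by (auto simp: row_mix_def)
    then have "det (row_mix d (\<lambda>i r s. w i * mconst (b i r s)) c) =
        Poly_Mapping.single ?t 1 * mconst (det (row_mix d b c))"
      by (simp add: det_row_mix_scale prod_w mc.hom_det)
    also have "\<dots> = Poly_Mapping.single ?t (det (row_mix d b c))"
      by (simp add: mconst_def mult_single)
    finally show "?F (det (row_mix d (\<lambda>i r s. w i * mconst (b i r s)) c)) =
        (\<Prod>i<m. one_minus_deriv_coeff (card {r. r < d \<and> c r = i})) * det (row_mix d b c)"
      using keys
      by (simp add: meval0_foldr_one_minus_mderiv_single atLeast0LessThan)
         (simp add: lk flip: atLeast0LessThan)
  qed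
  finally show ?thesis .
qed

section \<open>Averaging over rank-one summands\<close>

text \<open>A choice using \<open>i\<close> more than once has coefficient 0; every other choice
  gives a determinant affine in \<open>b i\<close>.\<close>

lemma mixed_det_affine:
  fixes b :: "nat \<Rightarrow> nat \<Rightarrow> nat \<Rightarrow> 'a :: comm_ring_1"
  assumes "sum a J = 1" and i: "i < m"
  shows "mixed_det d m (b(i := \<lambda>r s. \<Sum>j\<in>J. a j * Z j r s)) =
    (\<Sum>j\<in>J. a j * mixed_det d m (b(i := Z j)))"
proof -
  let ?C = "\<lambda>c. (\<Prod>i<m. one_minus_deriv_coeff (card {r. r < d \<and> c r = i})) :: 'a"
  have "?C c * det (row_mix d (b(i := \<lambda>r s. \<Sum>j\<in>J. a j * Z j r s)) c) =
      (\<Sum>j\<in>J. a j * (?C c * det (row_mix d (b(i := Z j)) c)))" for c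
  proof (cases "card {r. r < d \<and> c r = i} \<le> 1")
    case True
    show ?thesis
      unfolding det_row_mix_affine[OF assms(1) True] sum_distrib_left by (simp add: mult_ac)
  next
    case False
    have "(one_minus_deriv_coeff n :: 'a) = 0" if "\<not> n \<le> 1" for n
      using that by (simp add: one_minus_deriv_coeff_def)
    from this[OF False] have "?C c = 0"
      using i by (intro prod_zero) blast+
    then show ?thesis by simp
  qed
  then show ?thesis
    unfolding mixed_det_def sum_distrib_left by (subst sum.swap) simp
qed

text \<open>Affinity expands the averages one coordinate at a time. The family \<open>b\<close> of
  default values is arbitrary, so that the induction can store the last average in it.\<close>

lemma affine_average:
  fixes F :: "(nat \<Rightarrow> 'b) \<Rightarrow> 'a :: comm_ring_1"
  assumes "finite J"
    and "\<And>i b. i < m \<Longrightarrow> F (b(i := avg i)) = (\<Sum>j\<in>J. a j * F (b(i := Z i j)))"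
  shows "F (\<lambda>i. if i < m then avg i else b i) =
    (\<Sum>g\<in>{..<m} \<rightarrow>\<^sub>E J. (\<Prod>i<m. a (g i)) * F (\<lambda>i. if i < m then Z i (g i) else b i))"
  using assms(2)
proof (induction m arbitrary: b)
  case 0
  then show ?case by simp
next
  case (Suc m)
  let ?G = "{..<m} \<rightarrow>\<^sub>E J"
  have upd: "(\<lambda>i. if i < m then f i else (b(m := y)) i) = (\<lambda>i. if i < m then f i else b i)(m := y)"
    for f :: "nat \<Rightarrow> 'b" and y
    by auto
  have upd': "(\<lambda>i. if i < Suc m then f i else b i) = (\<lambda>i. if i < m then f i else b i)(m := f m)"
    for f :: "nat \<Rightarrow> 'b"
    by auto
  have "F (\<lambda>i. if i < Suc m then avg i else b i) =
      F (\<lambda>i. if i < m then avg i else (b(m := avg m)) i)"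
    unfolding upd upd' ..
  also have "\<dots> = (\<Sum>g\<in>?G. (\<Prod>i<m. a (g i)) *
      F (\<lambda>i. if i < m then Z i (g i) else (b(m := avg m)) i))"
    using Suc.prems by (intro Suc.IH) simp
  also have "\<dots> = (\<Sum>g\<in>?G. \<Sum>j\<in>J. (\<Prod>i<m. a (g i)) * (a j *
      F ((\<lambda>i. if i < m then Z i (g i) else b i)(m := Z m j))))"
    unfolding upd Suc.prems[OF lessI] sum_distrib_left ..
  also have "\<dots> = (\<Sum>(j, g)\<in>J \<times> ?G. (\<Prod>i<m. a (g i)) * (a j *
      F ((\<lambda>i. if i < m then Z i (g i) else b i)(m := Z m j))))"
    by (subst sum.swap) (simp add: sum.cartesian_product)
  also have "\<dots> = (\<Sum>(j, g)\<in>J \<times> ?G. (\<Prod>i<Suc m. a ((g(m := j)) i)) *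
      F (\<lambda>i. if i < Suc m then Z i ((g(m := j)) i) else b i))"
  proof (rule sum.cong[OF refl], clarify)
    fix j g
    have "(\<lambda>i. if i < m then Z i (g i) else b i)(m := Z m j) =
        (\<lambda>i. if i < Suc m then Z i ((g(m := j)) i) else b i)"
      by auto
    then show "(\<Prod>i<m. a (g i)) * (a j * F ((\<lambda>i. if i < m then Z i (g i) else b i)(m := Z m j))) =
        (\<Prod>i<Suc m. a ((g(m := j)) i)) * F (\<lambda>i. if i < Suc m then Z i ((g(m := j)) i) else b i)"
      by (simp add: mult_ac)
  qed
  \<comment> \<open>A function on \<open>{..<Suc m}\<close> is a pair of its value \<open>j\<close>
    at \<open>m\<close> and its restriction \<open>g\<close>.\<close>
  also have "\<dots> = (\<Sum>g\<in>{..<Suc m} \<rightarrow>\<^sub>E J. (\<Prod>i<Suc m. a (g i)) *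
      F (\<lambda>i. if i < Suc m then Z i (g i) else b i))"
    unfolding lessThan_Suc[of m] PiE_insert_eq
    by (subst sum.reindex[OF inj_combinator]) (simp_all add: case_prod_unfold)
  finally show ?case .
qed

text \<open>
  For rank-one summands the determinant is affine in every $z_i$, so that applying
  $1 - \partial_{z_i}$ and setting $z_i = 0$ amounts to setting $z_i = -1$.
\<close>

lemma mixed_det_rank_one:
  fixes b :: "nat \<Rightarrow> nat \<Rightarrow> nat \<Rightarrow> 'a :: comm_ring_1"
  assumes b: "\<And>i r s. i < m \<Longrightarrow> b i r s = p i r * q i s"
  shows "mixed_det d m b = det (mat d d (\<lambda>(r, s). b m r s - (\<Sum>i<m. b i r s)))"
proof -
  define w where "w i = (if i < m then - 1 else 1 :: 'a)" for i
  have "b m r s - (\<Sum>i<m. b i r s) = (\<Sum>i\<le>m. w i * b i r s)" for r s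
    by (simp add: w_def sum_negf flip: lessThan_Suc_atMost)
  then have "det (mat d d (\<lambda>(r, s). b m r s - (\<Sum>i<m. b i r s))) =
      (\<Sum>c\<in>{0..<d} \<rightarrow>\<^sub>E {..m}. (\<Prod>r = 0..<d. w (c r)) * det (row_mix d b c))"
    by (simp add: det_sum_eq_sum_det_row_mix det_row_mix_scale)
  also have "\<dots> = mixed_det d m b"
    unfolding mixed_det_def
  proof (rule sum.cong[OF refl])
    fix c assume c: "c \<in> {0..<d} \<rightarrow>\<^sub>E {..m}"
    let ?n = "\<lambda>i. card {r. r < d \<and> c r = i}"
    show "(\<Prod>r = 0..<d. w (c r)) * det (row_mix d b c) =
        (\<Prod>i<m. one_minus_deriv_coeff (?n i)) * det (row_mix d b c)"
    \<comment> \<open>A choice using a rank-one member twice gives determinant 0, whatever its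
      coefficient. Otherwise each \<open>?n i\<close> with \<open>i < m\<close> is 0 or 1, where
      \<open>(- 1) ^ n\<close> agrees with \<open>one_minus_deriv_coeff n\<close>.\<close>
    proof (cases "\<exists>i<m. ?n i > 1")
      case True
      then obtain i where "i < m" "?n i > 1" by blast
      then have "det (row_mix d b c) = 0"
        using b by (intro det_row_mix_rank_one_eq_0[of b i "p i" "q i"])
      then show ?thesis by simp
    next
      case False
      \<comment> \<open>Rows are grouped by the member they come from; member \<open>m\<close> has
        weight 1 and then drops out.\<close>
      have "(\<Prod>r = 0..<d. w (c r)) = (\<Prod>i\<le>m. \<Prod>r\<in>{r \<in> {0..<d}. c r = i}. w (c r))"
        using c by (intro prod.group[symmetric]) auto
      also have "\<dots> = (\<Prod>i\<le>m. w i ^ ?n i)"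
        by simp
      also have "\<dots> = (\<Prod>i<m. w i ^ ?n i)"
        by (simp add: w_def flip: lessThan_Suc_atMost)
      also have "\<dots> = (\<Prod>i<m. one_minus_deriv_coeff (?n i))"
      proof (rule prod.cong[OF refl])
        fix i assume i: "i \<in> {..<m}"
        then have "w i ^ n = one_minus_deriv_coeff n" if "n \<le> 1" for n
          using that by (cases n) (simp_all add: w_def one_minus_deriv_coeff_def)
        moreover have "?n i \<le> 1"
          using False i by (meson lessThan_iff not_le)
        ultimately show "w i ^ ?n i = one_minus_deriv_coeff (?n i)" .
      qed
      finally show ?thesis by simp
    qed
  qed
  finally show ?thesis ..
qed

section \<open>Characteristic polynomials\<close>

lemma const_poly_sum: "[:\<Sum>i\<in>I. f i:] = (\<Sum>i\<in>I. [:f i:])"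
  by (rule poly_eqI) (simp add: coeff_sum coeff_pCons split: nat.split)

lemma char_poly_four_block_upper_right_zero:
  fixes A1 :: "'a :: idom mat"
  assumes "A1 \<in> carrier_mat n n" "A3 \<in> carrier_mat m n" "A4 \<in> carrier_mat m m"
  shows "char_poly (four_block_mat A1 (0\<^sub>m n m) A3 A4) = char_poly A1 * char_poly A4"
proof -
  have "char_poly_matrix (four_block_mat A1 (0\<^sub>m n m) A3 A4) =
      four_block_mat (char_poly_matrix A1) (0\<^sub>m n m) (map_mat (\<lambda>a. [:- a:]) A3) (char_poly_matrix A4)"
    using assms by (intro eq_matI) (auto simp: char_poly_matrix_def)
  then show ?thesis
    using assms unfolding char_poly_def
    by (simp add: det_four_block_mat_upper_right_zero[of _ n _ m])
qed

lemma char_poly_zero_mat: "char_poly (0\<^sub>m n n :: 'a :: comm_ring_1 mat) = [:0, 1:] ^ n"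
proof -
  have "char_poly_matrix (0\<^sub>m n n :: 'a mat) = [:0, 1:] \<cdot>\<^sub>m 1\<^sub>m n"
    by (auto simp: char_poly_matrix_def)
  then show ?thesis by (simp add: char_poly_def)
qed

text \<open>Conjugation by the unipotent block matrix \<open>?S\<close> turns \<open>?N\<close> into
  \<open>?M\<close>. Both are block triangular, so comparing their characteristic polynomials gives
  the identity, in a form that avoids negative powers for all \<open>n\<close> and
  \<open>m\<close>.\<close>

lemma char_poly_mult_swap:
  fixes P Q :: "'a :: idom mat"
  assumes P: "P \<in> carrier_mat n m" and Q: "Q \<in> carrier_mat m n"
  shows "char_poly (P * Q) * [:0, 1:] ^ m = [:0, 1:] ^ n * char_poly (Q * P)"
proof -
  let ?M = "four_block_mat (P * Q) (0\<^sub>m n m) Q (0\<^sub>m m m)"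
  let ?N = "four_block_mat (0\<^sub>m n n) (0\<^sub>m n m) Q (Q * P)"
  let ?S = "four_block_mat (1\<^sub>m n) P (0\<^sub>m m n) (1\<^sub>m m)"
  let ?T = "four_block_mat (1\<^sub>m n) (- P) (0\<^sub>m m n) (1\<^sub>m m)"
  have PQ: "P * Q \<in> carrier_mat n n" and QP: "Q * P \<in> carrier_mat m m"
    and mP: "- P \<in> carrier_mat n m"
    using P Q by auto
  have [simp]: "- 0\<^sub>m m m = (0\<^sub>m m m :: 'a mat)" "P + - P = 0\<^sub>m n m"
    using P by auto
  have "?S * ?T = four_block_mat (1\<^sub>m n) (0\<^sub>m n m) (0\<^sub>m m n) (1\<^sub>m m)"
    using P mP
    by (subst mult_four_block_mat[where ?n1.0 = n and ?n2.0 = m])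
       auto
  then have ST: "?S * ?T = 1\<^sub>m (n + m)"
    by simp
  have "?T * ?S = four_block_mat (1\<^sub>m n) (0\<^sub>m n m) (0\<^sub>m m n) (1\<^sub>m m)"
    using P mP
    by (subst mult_four_block_mat[where ?n1.0 = n and ?n2.0 = m]) auto
  then have TS: "?T * ?S = 1\<^sub>m (n + m)"
    by simp
  have SN: "?S * ?N = four_block_mat (P * Q) (P * (Q * P)) Q (Q * P)"
    using P Q PQ QP
    by (subst mult_four_block_mat[where ?n1.0 = n and ?n2.0 = m]) auto
  have "?S * ?N * ?T = four_block_mat (P * Q) (P * Q * (- P) + P * (Q * P)) Q (Q * (- P) + Q * P)"
    unfolding SN using P Q PQ QP mP
    by (subst mult_four_block_mat[where ?n1.0 = n and ?n2.0 = m]) auto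
  also have "\<dots> = ?M"
    using P Q PQ QP
    by (intro cong_four_block_mat refl) auto
  finally have "?M = ?S * ?N * ?T" ..
  then have "similar_mat ?M ?N"
    using P Q ST TS by (intro similar_matI[of _ _ ?S ?T "n + m"]) auto
  then have "char_poly ?M = char_poly ?N"
    by (rule char_poly_similar)
  then show ?thesis
    using P Q PQ QP
    by (simp add: char_poly_four_block_upper_right_zero[of _ n _ m] char_poly_zero_mat)
qed

section \<open>Ordered partitions as functions\<close>

text \<open>\<open>g i\<close> is the number of the block containing \<open>i\<close>: covering
  gives its existence, disjointness its uniqueness.\<close>

lemma bij_betw_ordered_partitions:
  "bij_betw (\<lambda>g. map (\<lambda>j. {i. i < m \<and> g i = j}) [0..<k]) ({..<m} \<rightarrow>\<^sub>E {..<k})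
    (ordered_partitions k m)"
proof (rule bij_betwI')
  fix g h assume g: "g \<in> {..<m} \<rightarrow>\<^sub>E {..<k}" and h: "h \<in> {..<m} \<rightarrow>\<^sub>E {..<k}"
  show "map (\<lambda>j. {i. i < m \<and> g i = j}) [0..<k] = map (\<lambda>j. {i. i < m \<and> h i = j}) [0..<k]
    \<longleftrightarrow> g = h"
  proof
    assume eq: "map (\<lambda>j. {i. i < m \<and> g i = j}) [0..<k] = map (\<lambda>j. {i. i < m \<and> h i = j}) [0..<k]"
    show "g = h"
    proof (rule PiE_ext[OF g h])
      fix i assume i: "i \<in> {..<m}"
      with g have "g i < k" by auto
      with eq have "{i'. i' < m \<and> g i' = g i} = {i'. i' < m \<and> h i' = g i}"
        by simp
      moreover have "i \<in> {i'. i' < m \<and> g i' = g i}"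
        using i by simp
      ultimately have "i \<in> {i'. i' < m \<and> h i' = g i}"
        by (rule back_subst[where P = "\<lambda>A. i \<in> A", rotated])
      then show "g i = h i" by simp
    qed
  qed simp
next
  fix g assume "g \<in> {..<m} \<rightarrow>\<^sub>E {..<k}"
  then show "map (\<lambda>j. {i. i < m \<and> g i = j}) [0..<k] \<in> ordered_partitions k m"
    by (auto simp: ordered_partitions_def disjoint_family_on_def)
next
  fix S assume S: "S \<in> ordered_partitions k m"
  then have len: "length S = k" and disj: "disjoint_family_on (\<lambda>j. S ! j) {..<k}"
    and un: "(\<Union>j<k. S ! j) = {..<m}"
    by (auto simp: ordered_partitions_def)
  have "\<exists>j. j < k \<and> i \<in> S ! j" if "i < m" for i
    using that un by blast
  then obtain f where f: "\<And>i. i < m \<Longrightarrow> f i < k \<and> i \<in> S ! f i"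
    by metis
  have uniq: "f i = j" if "i \<in> S ! j" "j < k" "i < m" for i j
    using disj f[OF that(3)] that by (auto simp: disjoint_family_on_def)
  have "S = map (\<lambda>j. {i. i < m \<and> restrict f {..<m} i = j}) [0..<k]"
  proof (rule nth_equalityI)
    fix j assume "j < length S"
    then have j: "j < k" by (simp add: len)
    then have "S ! j \<subseteq> {..<m}" using un by blast
    with j f uniq show "S ! j = map (\<lambda>j. {i. i < m \<and> restrict f {..<m} i = j}) [0..<k] ! j"
      by auto
  qed (simp add: len)
  moreover have "restrict f {..<m} \<in> {..<m} \<rightarrow>\<^sub>E {..<k}"
    using f by auto
  ultimately show "\<exists>g\<in>{..<m} \<rightarrow>\<^sub>E {..<k}. S = map (\<lambda>j. {i. i < m \<and> g i = j}) [0..<k]"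
    by blast
qed

section \<open>Characteristic polynomials of principal submatrices of a product\<close>

lemma bij_betw_pick:
  assumes "finite I"
  shows "bij_betw (pick I) {..<card I} I"
proof -
  have "inj_on (pick I) {..<card I}"
    by (rule linorder_inj_onI) (auto dest: pick_mono_le)
  moreover have "pick I ` {..<card I} \<subseteq> I"
    by (auto intro: pick_in_set_le)
  ultimately show ?thesis
    using assms by (simp add: bij_betw_def card_image card_subset_eq)
qed

text \<open>The submatrix is the product of the rows of \<open>Q\<close> and the columns of
  \<open>P\<close> selected by \<open>I\<close>, which \<open>pick I\<close> enumerates. Swapping
  the two factors gives a sum of rank-one matrices over \<open>I\<close>.\<close>

lemma char_poly_submatrix_mult:
  fixes P Q :: "'a :: idom mat"
  assumes P: "P \<in> carrier_mat d N" and Q: "Q \<in> carrier_mat N d" and I: "I \<subseteq> {..<N}"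
  shows "[:0, 1:] ^ d * char_poly (submatrix (a \<cdot>\<^sub>m (Q * P)) I I) =
    char_poly (mat d d (\<lambda>(r, s). \<Sum>c\<in>I. a * P $$ (r, c) * Q $$ (c, s))) * [:0, 1:] ^ card I"
proof -
  let ?m = "card I"
  define P' where "P' = mat d ?m (\<lambda>(r, c). a * P $$ (r, pick I c))"
  define Q' where "Q' = mat ?m d (\<lambda>(c, s). Q $$ (pick I c, s))"
  have fin: "finite I"
    using I finite_subset by blast
  have pick: "pick I c < N" if "c < ?m" for c
    using pick_in_set_le[OF that] I by auto
  have "{i. i < N \<and> i \<in> I} = I"
    using I by auto
  then have "submatrix (a \<cdot>\<^sub>m (Q * P)) I I = Q' * P'"
    using P Q pick
    by (auto simp: submatrix_def P'_def Q'_def scalar_prod_def sum_distrib_left mult_ac)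
  moreover have "mat d d (\<lambda>(r, s). \<Sum>c\<in>I. a * P $$ (r, c) * Q $$ (c, s)) = P' * Q'"
  proof (rule eq_matI)
    fix r s assume "r < dim_row (P' * Q')" "s < dim_col (P' * Q')"
    then have rs: "r < d" "s < d" by (auto simp: P'_def Q'_def)
    have "(\<Sum>c\<in>I. a * P $$ (r, c) * Q $$ (c, s)) =
        (\<Sum>c<?m. a * P $$ (r, pick I c) * Q $$ (pick I c, s))"
      by (rule sum.reindex_bij_betw[OF bij_betw_pick[OF fin], symmetric])
    with rs show "mat d d (\<lambda>(r, s). \<Sum>c\<in>I. a * P $$ (r, c) * Q $$ (c, s)) $$ (r, s) =
        (P' * Q') $$ (r, s)"
      by (simp add: P'_def Q'_def scalar_prod_def atLeast0LessThan)
  qed (auto simp: P'_def Q'_def)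
  ultimately show ?thesis
    using char_poly_mult_swap[of P' d ?m Q'] by (simp add: P'_def Q'_def)
qed

section \<open>The mixed characteristic polynomial as a multiple of \<open>psi\<close>\<close>

lemma to_fract_power: "to_fract (x ^ n) = to_fract x ^ n"
  by (induction n) simp_all

theorem theorem3p8:
  fixes d m k :: nat
    and X :: "nat \<Rightarrow> complex mat"
    and u v :: "nat \<Rightarrow> nat \<Rightarrow> complex vec"
    and U V :: "nat \<Rightarrow> complex mat"
    and A :: "complex mat"
  assumes k_pos: "k \<ge> 1"
    and X_dim: "\<And>i. i < m \<Longrightarrow> X i \<in> carrier_mat d d"
    and X_rank: "\<And>i. i < m \<Longrightarrow> vec_space.rank d (X i) \<le> k"
    and u_dim: "\<And>i j. i < m \<Longrightarrow> j < k \<Longrightarrow> u i j \<in> carrier_vec d"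
    and v_dim: "\<And>i j. i < m \<Longrightarrow> j < k \<Longrightarrow> v i j \<in> carrier_vec d"
    and X_eq: "\<And>i. i < m \<Longrightarrow> X i = mat_sum d d (\<lambda>j. outer_prod (u i j) (v i j)) {..<k}"
    and U_eq: "\<And>j. j < k \<Longrightarrow> U j = mat_of_cols d (map (\<lambda>i. u i j) [0..<m])"
    and V_eq: "\<And>j. j < k \<Longrightarrow> V j = mat_of_cols d (map (\<lambda>i. v i j) [0..<m])"
    and A_eq: "A = block_col m d k (\<lambda>j. mat_adjoint (V j)) * block_row d m k U"
  shows "to_fract (mixed_char_poly d m X)
    = to_fract [:0, 1:] powi (int d - int m) * to_fract (psi k m (of_nat k \<cdot>\<^sub>m A))"
proof -
  let ?x = "[:0, 1:] :: complex poly"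
  let ?K = "of_nat k :: complex"
  let ?G = "{..<m} \<rightarrow>\<^sub>E {..<k}"
  \<comment> \<open>The factor \<open>?K\<close> compensates for the weights \<open>1 / ?K\<close>
    in \<open>avg\<close>, which sum to 1 as affinity demands. Entries are constant polynomials
    because \<open>mixed_det\<close> is used over the polynomials in x.\<close>
  define Z where "Z i j r s = [:?K * u i j $ r * cnj (v i j $ s):]" for i j r s
  \<comment> \<open>Indices below \<open>m\<close> get overridden; what remains is the summand x I
    at index \<open>m\<close>.\<close>
  define b where "b i r s = (if r = s then ?x else 0)" for i r s :: nat
  define avg where "avg i r s = (\<Sum>j<k. [:1 / ?K:] * Z i j r s)" for i r s
  define M where "M g = mat d d (\<lambda>(r, s). \<Sum>i<m. ?K * u i (g i) $ r * cnj (v i (g i) $ s))"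
    for g :: "nat \<Rightarrow> nat"
  define parts where "parts g = map (\<lambda>j. {i. i < m \<and> g i = j}) [0..<k]" for g :: "nat \<Rightarrow> nat"
  have K: "?K \<noteq> 0"
    using k_pos by simp
  have X_entry: "[:X i $$ (r, s):] = avg i r s" if "i < m" "r < d" "s < d" for i r s
  proof -
    have "X i $$ (r, s) = (\<Sum>j<k. u i j $ r * cnj (v i j $ s))"
      using that
      by (auto simp: X_eq mat_sum_def outer_prod_def carrier_vecD[OF u_dim] carrier_vecD[OF v_dim]
          intro!: sum.cong)
    then show ?thesis
      using K by (simp add: avg_def Z_def const_poly_sum)
  qed
  have "mixed_char_poly d m X = mixed_det d m (\<lambda>i. if i < m then avg i else b i)"
  proof -
    have "mconst ?x \<cdot>\<^sub>m 1\<^sub>m d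
        + mat_sum d d (\<lambda>i. mvar i \<cdot>\<^sub>m map_mat (\<lambda>a. mconst [:a:]) (X i)) {..<m} =
      mat d d (\<lambda>(r, s). mconst (b m r s) + (\<Sum>i<m. mvar i * mconst (avg i r s)))"
      by (intro eq_matI) (auto simp: mat_sum_def b_def X_entry mconst_def
          carrier_matD[OF X_dim] intro!: sum.cong)
    then show ?thesis
      unfolding mixed_char_poly_def
      by (simp flip: meval0_foldr_one_minus_mderiv_det)
  qed
  also have "\<dots> = (\<Sum>g\<in>?G. (\<Prod>i<m. [:1 / ?K:]) *
      mixed_det d m (\<lambda>i. if i < m then Z i (g i) else b i))"
  proof (rule affine_average[where F = "mixed_det d m" and a = "\<lambda>_. [:1 / ?K:]"
        and avg = avg and Z = Z])
    fix i f assume "i < m"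
    moreover have "(\<Sum>j<k. [:1 / ?K:]) = 1"
      using K by (simp add: of_nat_poly)
    ultimately show "mixed_det d m (f(i := avg i)) =
        (\<Sum>j<k. [:1 / ?K:] * mixed_det d m (f(i := Z i j)))"
      using mixed_det_affine[of "\<lambda>_. [:1 / ?K:]" "{..<k}" i m d f "Z i"]
      by (simp add: avg_def[abs_def])
  qed simp
  also have "\<dots> = smult (1 / ?K ^ m) (\<Sum>g\<in>?G. char_poly (M g))"
  proof -
    have "mixed_det d m (\<lambda>i. if i < m then Z i (g i) else b i) = char_poly (M g)" for g
    proof -
      have "mixed_det d m (\<lambda>i. if i < m then Z i (g i) else b i) =
          det (mat d d (\<lambda>(r, s). b m r s - (\<Sum>i<m. Z i (g i) r s)))"
        by (subst mixed_det_rank_one[where p = "\<lambda>i r. [:?K * u i (g i) $ r:]"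
              and q = "\<lambda>i s. [:cnj (v i (g i) $ s):]"]) (simp_all add: Z_def)
      also have "mat d d (\<lambda>(r, s). b m r s - (\<Sum>i<m. Z i (g i) r s)) = char_poly_matrix (M g)"
        by (auto simp: char_poly_matrix_def M_def b_def Z_def simp flip: const_poly_sum)
      finally show ?thesis by (simp add: char_poly_def)
    qed
    moreover have "[:1 / ?K:] ^ m = [:1 / ?K ^ m:]"
      by (induction m) simp_all
    ultimately show ?thesis
      by (simp add: smult_sum2)
  qed
  finally have mixed: "mixed_char_poly d m X = smult (1 / ?K ^ m) (\<Sum>g\<in>?G. char_poly (M g))" .

  \<comment> \<open>Powers of x stay on both sides because either of \<open>d\<close> and
    \<open>m\<close> may be the larger.\<close>
  have swap: "?x ^ d * char_poly (partition_submatrix k m (?K \<cdot>\<^sub>m A) (parts g)) =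
      char_poly (M g) * ?x ^ m" if g: "g \<in> ?G" for g
  proof -
    let ?P = "block_row d m k U" and ?Q = "block_col m d k (\<lambda>j. mat_adjoint (V j))"
    let ?f = "\<lambda>i. g i * m + i"
    \<comment> \<open>The partition \<open>parts g\<close> selects, for each \<open>i\<close>,
      position \<open>i\<close> of block \<open>g i\<close>.\<close>
    define I where "I = ?f ` {..<m}"
    have g_lt: "g i < k" if "i < m" for i
      using g that by auto
    have I_parts: "(\<Union>j<k. (\<lambda>s. j * m + s) ` (parts g ! j)) = I"
      using g_lt by (auto simp: I_def parts_def)
    \<comment> \<open>The remainder mod \<open>m\<close> recovers \<open>i\<close>, so
      \<open>I\<close> has exactly \<open>m\<close> elements.\<close>
    have inj: "inj_on ?f {..<m}"
    proof (rule inj_onI)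
      fix i i' assume "i \<in> {..<m}" "i' \<in> {..<m}" "?f i = ?f i'"
      then have "?f i mod m = ?f i' mod m" "i < m" "i' < m" by auto
      then show "i = i'" by simp
    qed
    have f_lt: "?f i < k * m" if "i < m" for i
    proof -
      have "?f i < Suc (g i) * m"
        using that by simp
      also have "\<dots> \<le> k * m"
        using g_lt[OF that] by (intro mult_le_mono1) simp
      finally show ?thesis .
    qed
    \<comment> \<open>Quotient and remainder of \<open>?f i\<close> by \<open>m\<close> are
      \<open>g i\<close> and \<open>i\<close>, which picks out the vectors with second index
      \<open>g i\<close>.\<close>
    have entry: "?P $$ (r, ?f i) = u i (g i) $ r" "?Q $$ (?f i, r) = cnj (v i (g i) $ r)"
      if "i < m" "r < d" for i r
      using that f_lt[OF that(1)] g_lt[OF that(1)] u_dim[OF that(1)] v_dim[OF that(1)]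
      by (auto simp: block_row_def block_col_def U_eq V_eq mat_adjoint_def mat_of_rows_def
          mat_of_cols_def cols_def col_def)
    have "mat d d (\<lambda>(r, s). \<Sum>c\<in>I. ?K * ?P $$ (r, c) * ?Q $$ (c, s)) = M g"
      unfolding M_def I_def sum.reindex[OF inj]
      by (auto simp: entry intro!: sum.cong)
    moreover have "card I = m"
      using inj by (simp add: I_def card_image)
    moreover have "I \<subseteq> {..<k * m}"
      using f_lt by (auto simp: I_def)
    ultimately show ?thesis
      using char_poly_submatrix_mult[of ?P d "k * m" ?Q I ?K]
      by (simp add: partition_submatrix_def I_parts A_eq block_row_def block_col_def)
  qed
  have "psi k m (?K \<cdot>\<^sub>m A) = smult (1 / ?K ^ m)
      (\<Sum>g\<in>?G. char_poly (partition_submatrix k m (?K \<cdot>\<^sub>m A) (parts g)))"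
    unfolding psi_def parts_def
    by (subst sum.reindex_bij_betw[OF bij_betw_ordered_partitions, symmetric]) (rule refl)
  then have "?x ^ d * psi k m (?K \<cdot>\<^sub>m A) = mixed_char_poly d m X * ?x ^ m"
    unfolding mixed
    by (simp only: mult_smult_right mult_smult_left sum_distrib_left sum_distrib_right swap
        cong: sum.cong)
  then have eq: "to_fract ?x ^ d * to_fract (psi k m (?K \<cdot>\<^sub>m A)) =
      to_fract (mixed_char_poly d m X) * to_fract ?x ^ m"
    by (simp flip: to_fract_mult to_fract_power)
  \<comment> \<open>The exponent may be negative; in the fraction field x is invertible, so the
    power splits into a quotient.\<close>
  have "to_fract ?x \<noteq> 0"
    by simp
  then have powi: "to_fract ?x powi (int d - int m) = to_fract ?x ^ d / to_fract ?x ^ m"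
    by (simp add: power_int_diff)
  show ?thesis
    unfolding powi using eq \<open>to_fract ?x \<noteq> 0\<close> by (simp add: nonzero_eq_divide_eq)
qed

end
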